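(* Let $b>0$ and let $K\ge1$ be an integer. For every $D_{K+1}\ge 0$ there is a constant $C(D_{K+1})$ such that the following holds. Let $f:\mathbb{R}\to\mathbb{R}$ be a periodic function with period $2b$ that is either even or odd, and suppose that $f^{(K+1)}$ exists everywhere with $|f^{(K+1)}(x)|\le D_{K+1}$ for all $x$. Let $N=2M$ be an even positive integer and let $a_j$ ($1\le j<M$) be the coefficients of the trigonometric interpolant $f_M$ of $f$ defined in the context. Then $$|a_j|\le\frac{C(D_{K+1})}{N^{K+1}\sin^{K+1}\frac{\pi j}{N}},\qquad 1\le j<M.$$
   Context: For $N=2M$ put $x_k=-b+\frac{2b}{N}k$ and $y_k=f(x_k)$, $0\le k<N$. If $f$ is even, $f_M(x)=\sum_{0\le j<M}a_j\cos\frac{j\pi x}{b}$ with $a_0=\frac1M\sum_{0\le j<M}y_{2j}$ and $a_j=\frac2N\sum_{0\le k<N}(-1)^jy_k\cos\frac{2\pi jk}{N}$ for $1\le j<M$. If $f$ is odd, $f_M(x)=\sum_{0\le j<M}a_j\sin\frac{j\pi x}{b}$ with $a_j=\frac2N\sum_{0\le k<N}(-1)^jy_k\sin\frac{2\pi jk}{N}$ for $0\le j<M$. The constant $C(D_{K+1})$ may depend on $b$ and $K$, which are fixed, and on $D_{K+1}$, but not on $j$ or $N$. *)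

theory Defs
  imports "HOL-Analysis.Analysis"
begin

definition even_function :: "(real \<Rightarrow> real) \<Rightarrow> bool" where
  "even_function f \<longleftrightarrow> (\<forall>x. f (- x) = f x)"

definition odd_function :: "(real \<Rightarrow> real) \<Rightarrow> bool" where
  "odd_function f \<longleftrightarrow> (\<forall>x. f (- x) = - f x)"

definition periodic_with :: "real \<Rightarrow> (real \<Rightarrow> real) \<Rightarrow> bool" where
  "periodic_with p f \<longleftrightarrow> (\<forall>x. f (x + p) = f x)"

text \<open>
  \<^const>\<open>deriv\<close> is a total choice operator, so existence of the \<open>n\<close>-th derivative everywhere
  has to be required explicitly, order by order; the \<open>n\<close>-th derivative itself is then
  \<open>(deriv ^^ n) f\<close>.
\<close>
definition nth_deriv_exists :: "nat \<Rightarrow> (real \<Rightarrow> real) \<Rightarrow> bool" where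
  "nth_deriv_exists n f \<longleftrightarrow> (\<forall>k<n. \<forall>x. (deriv ^^ k) f differentiable (at x))"

definition node :: "real \<Rightarrow> nat \<Rightarrow> nat \<Rightarrow> real" where
  "node b N k = - b + 2 * b / real N * real k"

text \<open>
  Coefficients of the trigonometric interpolant with \<open>N = 2 * M\<close> nodes. The constant
  coefficient of the cosine polynomial is an average over the nodes of even index only,
  so it is not the value at \<open>j = 0\<close> of the general formula.
\<close>
definition cos_interp_coeff :: "real \<Rightarrow> (real \<Rightarrow> real) \<Rightarrow> nat \<Rightarrow> nat \<Rightarrow> real" where
  "cos_interp_coeff b f M j =
     (let N = 2 * M; y = (\<lambda>k. f (node b N k)) in
      if j = 0 then 1 / real M * (\<Sum>i<M. y (2 * i))
      else 2 / real N * (\<Sum>k<N. (- 1) ^ j * y k * cos (2 * pi * real j * real k / real N)))"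

definition sin_interp_coeff :: "real \<Rightarrow> (real \<Rightarrow> real) \<Rightarrow> nat \<Rightarrow> nat \<Rightarrow> real" where
  "sin_interp_coeff b f M j =
     (let N = 2 * M; y = (\<lambda>k. f (node b N k)) in
      2 / real N * (\<Sum>k<N. (- 1) ^ j * y k * sin (2 * pi * real j * real k / real N)))"

definition cos_interpolant :: "real \<Rightarrow> (real \<Rightarrow> real) \<Rightarrow> nat \<Rightarrow> real \<Rightarrow> real" where
  "cos_interpolant b f M x = (\<Sum>j<M. cos_interp_coeff b f M j * cos (real j * pi * x / b))"

definition sin_interpolant :: "real \<Rightarrow> (real \<Rightarrow> real) \<Rightarrow> nat \<Rightarrow> real \<Rightarrow> real" where
  "sin_interpolant b f M x = (\<Sum>j<M. sin_interp_coeff b f M j * sin (real j * pi * x / b))"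

end

(* Summation by parts with a root of unity z: passing from samples of f to samples of its forward
   difference multiplies the discrete Fourier sum by a factor of modulus |1 - z| = 2 sin(pi j / N).
   After K + 1 such steps the samples are (K + 1)-st differences of step 2 b / N, which the mean
   value theorem bounds by D (2 b / N)^(K + 1). The coefficients are, up to sign, 2 / N times the
   real or imaginary part of the Fourier sum of f. *)

theory Submission
  imports Defs
begin

definition fdiff :: "real \<Rightarrow> (real \<Rightarrow> real) \<Rightarrow> real \<Rightarrow> real" where
  "fdiff h f x = f (x + h) - f x"

text \<open>Translation by a fixed step commutes with differentiation, so a derivative passes
  through any number of differences.\<close>

lemma has_real_derivative_fdiff:
  assumes "\<And>x. (f has_real_derivative f' x) (at x)"
  shows "(fdiff h f has_real_derivative fdiff h f' x) (at x)"
  unfolding fdiff_def[abs_def]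
  by (intro DERIV_diff assms) (use assms DERIV_shift in blast)

lemma has_real_derivative_fdiff_funpow:
  assumes "\<And>x. (f has_real_derivative f' x) (at x)"
  shows "((fdiff h ^^ n) f has_real_derivative (fdiff h ^^ n) f' x) (at x)"
proof (induction n arbitrary: x)
  case 0
  show ?case using assms by simp
next
  case (Suc n)
  show ?case using has_real_derivative_fdiff[OF Suc.IH] by simp
qed

text \<open>Each difference costs one derivative and gains one factor \<open>h\<close>. The
  outermost difference is handled by the mean value inequality; the derivative that appears is an
  \<open>n\<close>-fold difference of \<open>deriv f\<close>, so the induction must leave
  \<open>f\<close> arbitrary.\<close>

lemma abs_fdiff_funpow_le:
  assumes "h \<ge> 0" and "nth_deriv_exists n f" and "\<And>x. \<bar>(deriv ^^ n) f x\<bar> \<le> D"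
  shows "\<bar>(fdiff h ^^ n) f x\<bar> \<le> h ^ n * D"
  using assms(2,3)
proof (induction n arbitrary: f x)
  case 0
  then show ?case by simp
next
  case (Suc n)
  let ?g = "(fdiff h ^^ n) f" and ?g' = "(fdiff h ^^ n) (deriv f)"
  have "(f has_real_derivative deriv f t) (at t)" for t
  proof -
    have "(deriv ^^ 0) f differentiable (at t)"
      using Suc.prems(1) unfolding nth_deriv_exists_def by blast
    then show ?thesis
      by (simp add: DERIV_deriv_iff_real_differentiable)
  qed
  then have deriv: "(?g has_real_derivative ?g' t) (at t)" for t
    by (rule has_real_derivative_fdiff_funpow)
  have "nth_deriv_exists n (deriv f)"
    unfolding nth_deriv_exists_def
  proof (intro allI impI)
    fix k t assume "k < n"
    then have "(deriv ^^ Suc k) f differentiable (at t)"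
      using Suc.prems(1) unfolding nth_deriv_exists_def by blast
    then show "(deriv ^^ k) (deriv f) differentiable (at t)"
      by (simp only: funpow_Suc_right o_apply)
  qed
  moreover have "\<bar>(deriv ^^ n) (deriv f) t\<bar> \<le> D" for t
    using Suc.prems(2)[of t] by (simp only: funpow_Suc_right o_apply)
  ultimately have bound: "\<bar>?g' t\<bar> \<le> h ^ n * D" for t
    by (rule Suc.IH)
  \<comment> \<open>Mean value inequality for \<open>?g\<close> between \<open>x\<close> and
    \<open>x + h\<close>, with the bound on \<open>?g'\<close> from the induction
    hypothesis.\<close>
  have "norm (?g (x + h) - ?g x) \<le> h ^ n * D * norm (x + h - x)"
    by (rule field_differentiable_bound[of UNIV]) (use deriv bound in auto)
  then show ?case
    using assms(1) by (simp add: fdiff_def[of h ?g] ac_simps)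
qed

lemma periodic_with_fdiff: "periodic_with p f \<Longrightarrow> periodic_with p (fdiff h f)"
  unfolding periodic_with_def fdiff_def by (metis add.assoc add.commute)

text \<open>Summation by parts around a cycle: \<open>f\<close> has period \<open>N * h\<close> and
  \<open>z ^ N = 1\<close>, so the summands repeat after \<open>N\<close> steps and no boundary
  terms survive.\<close>

lemma norm_root_of_unity_sum_fdiff:
  fixes z :: complex
  assumes "periodic_with (real N * h) f" and "z ^ N = 1" and "norm z = 1"
  shows "norm (\<Sum>k<N. of_real (fdiff h f (a + h * real k)) * z ^ k) =
    norm (1 - z) * norm (\<Sum>k<N. of_real (f (a + h * real k)) * z ^ k)"
proof -
  define t where "t k = of_real (f (a + h * real k)) * z ^ k" for k
  have "t N = t 0"
    using assms(1,2) by (simp add: t_def periodic_with_def mult.commute)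
  then have shift: "(\<Sum>k<N. t (Suc k)) = (\<Sum>k<N. t k)"
    using sum_lessThan_telescope[of t N] by (simp add: sum_subtractf)
  \<comment> \<open>The extra factor \<open>z\<close> pairs the sample at index \<open>k + 1\<close>
    with \<open>z ^ (k + 1)\<close>; it disappears in the norm because
    \<open>norm z = 1\<close>.\<close>
  have "z * (of_real (fdiff h f (a + h * real k)) * z ^ k) = t (Suc k) - z * t k" for k
    by (simp add: t_def fdiff_def algebra_simps)
  then have "z * (\<Sum>k<N. of_real (fdiff h f (a + h * real k)) * z ^ k) =
      (1 - z) * (\<Sum>k<N. t k)"
    by (simp add: sum_distrib_left sum_subtractf shift left_diff_distrib)
  then have "norm (z * (\<Sum>k<N. of_real (fdiff h f (a + h * real k)) * z ^ k)) =
      norm ((1 - z) * (\<Sum>k<N. t k))"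
    by (rule arg_cong)
  then show ?thesis
    by (simp add: norm_mult assms(3) t_def)
qed

lemma norm_root_of_unity_sum_fdiff_funpow:
  fixes z :: complex
  assumes "periodic_with (real N * h) f" and "z ^ N = 1" and "norm z = 1"
  shows "norm (\<Sum>k<N. of_real ((fdiff h ^^ n) f (a + h * real k)) * z ^ k) =
    norm (1 - z) ^ n * norm (\<Sum>k<N. of_real (f (a + h * real k)) * z ^ k)"
proof (induction n)
  case 0
  show ?case by simp
next
  case (Suc n)
  have "periodic_with (real N * h) ((fdiff h ^^ n) f)"
    by (induction n) (simp_all add: assms(1) periodic_with_fdiff)
  from norm_root_of_unity_sum_fdiff[OF this assms(2,3)] Suc.IH show ?case
    by simp
qed

text \<open>Length of a chord of the unit circle, from the half-angle formula for
  \<open>1 - cos t\<close>.\<close>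

lemma norm_one_minus_cis: "norm (1 - cis t) = 2 * \<bar>sin (t / 2)\<bar>"
proof -
  have "cos t = 1 - 2 * (sin (t / 2))\<^sup>2"
    using cos_double_sin[of "t / 2"] by simp
  moreover have "(norm (1 - cis t))\<^sup>2 = (1 - cos t)\<^sup>2 + (sin t)\<^sup>2"
    by (simp add: cmod_power2)
  moreover have "(1 - cos t)\<^sup>2 + (sin t)\<^sup>2 = 2 - 2 * cos t"
    using sin_cos_squared_add[of t] by (simp add: power2_diff)
  ultimately have "(norm (1 - cis t))\<^sup>2 = (2 * \<bar>sin (t / 2)\<bar>)\<^sup>2"
    by (simp add: power_mult_distrib)
  then show ?thesis
    by (rule power2_eq_imp_eq) auto
qed

lemma norm_discrete_Fourier_sum_le:
  assumes "b > 0" and "periodic_with (2 * b) f" and "nth_deriv_exists n f"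
    and "\<And>x. \<bar>(deriv ^^ n) f x\<bar> \<le> D" and "0 < j" and "j < N"
  shows "norm (\<Sum>k<N. of_real (f (node b N k)) * cis (2 * pi * real j / real N) ^ k)
    \<le> real N * (b ^ n * D / (real N ^ n * sin (pi * real j / real N) ^ n))"
    (is "norm ?S \<le> _")
proof -
  define h where "h = 2 * b / real N"
  define z where "z = cis (2 * pi * real j / real N)"
  define s where "s = sin (pi * real j / real N)"
  have "N > 0" using assms by simp
  \<comment> \<open>The angle lies strictly between \<open>0\<close> and \<open>pi\<close>.
    Positivity removes the absolute value in the chord length and later permits division by
    \<open>(2 * s) ^ n\<close>.\<close>
  then have s: "s > 0"
    unfolding s_def using assms(5,6) by (intro sin_gt_zero) (simp_all add: field_simps)
  have "norm (1 - z) = 2 * s"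
    using s norm_one_minus_cis[of "2 * pi * real j / real N"] by (simp add: z_def s_def)
  moreover have "z ^ N = 1"
    using \<open>N > 0\<close> cis_multiple_2pi[of "real j"] by (simp add: z_def Complex.DeMoivre mult.assoc)
  moreover have "periodic_with (real N * h) f"
    using assms(2) \<open>N > 0\<close> by (simp add: h_def)
  ultimately have "(2 * s) ^ n * norm ?S =
      norm (\<Sum>k<N. of_real ((fdiff h ^^ n) f (- b + h * real k)) * z ^ k)"
    using norm_root_of_unity_sum_fdiff_funpow[of N h f z n "- b"]
    by (simp add: node_def h_def z_def)
  also have "\<dots> \<le> (\<Sum>k<N. h ^ n * D)"
  proof (rule sum_norm_le)
    fix k
    show "norm (of_real ((fdiff h ^^ n) f (- b + h * real k)) * z ^ k) \<le> h ^ n * D"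
      using abs_fdiff_funpow_le[of h n f D "- b + h * real k"] assms
      by (simp add: norm_mult norm_power h_def z_def)
  qed
  finally have "norm ?S \<le> real N * (h ^ n * D) / (2 * s) ^ n"
    using s by (simp add: pos_le_divide_eq mult.commute)
  \<comment> \<open>The \<open>2 ^ n\<close> in \<open>h ^ n = (2 * b / N) ^ n\<close> cancels the
    one in \<open>(2 * s) ^ n\<close>.\<close>
  also have "\<dots> = real N * (b ^ n * D / (real N ^ n * s ^ n))"
    by (simp add: h_def power_divide power_mult_distrib)
  finally show ?thesis by (simp add: s_def)
qed

theorem theorem2p2:
  fixes b D :: real and K :: nat
  assumes "b > 0" and "K \<ge> 1" and "D \<ge> 0"
  shows "\<exists>C :: real. \<forall>(f :: real \<Rightarrow> real) (M :: nat) (N :: nat).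
    periodic_with (2 * b) f \<longrightarrow>
    nth_deriv_exists (K + 1) f \<longrightarrow>
    (\<forall>x. \<bar>(deriv ^^ (K + 1)) f x\<bar> \<le> D) \<longrightarrow>
    N > 0 \<longrightarrow> N = 2 * M \<longrightarrow>
    (even_function f \<longrightarrow>
       (\<forall>j. 1 \<le> j \<and> j < M \<longrightarrow>
          \<bar>cos_interp_coeff b f M j\<bar> \<le> C / (real N ^ (K + 1) * sin (pi * real j / real N) ^ (K + 1)))) \<and>
    (odd_function f \<longrightarrow>
       (\<forall>j. 1 \<le> j \<and> j < M \<longrightarrow>
          \<bar>sin_interp_coeff b f M j\<bar> \<le> C / (real N ^ (K + 1) * sin (pi * real j / real N) ^ (K + 1))))"
proof (intro exI allI impI)
  fix f :: "real \<Rightarrow> real" and M N :: nat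
  assume per: "periodic_with (2 * b) f" and ex: "nth_deriv_exists (K + 1) f"
    and bd: "\<forall>x. \<bar>(deriv ^^ (K + 1)) f x\<bar> \<le> D" and "N > 0" and N: "N = 2 * M"
  \<comment> \<open>The witness for \<open>C\<close>: the \<open>2\<close> comes from the
    normalisation \<open>2 / N\<close> of the coefficients, the rest from the Fourier sum bound with
    \<open>n = K + 1\<close>. It involves only \<open>b\<close>, \<open>K\<close> and
    \<open>D\<close>.\<close>
  let ?B = "2 * (b ^ (K + 1) * D)"
  let ?S = "\<lambda>j. \<Sum>k<N. of_real (f (node b N k)) * cis (2 * pi * real j / real N) ^ k"
  have pow: "cis (2 * pi * real j / real N) ^ k = cis (2 * pi * real j * real k / real N)" for j k
    by (simp add: Complex.DeMoivre mult_ac)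
  \<comment> \<open>The condition \<open>1 \<le> j\<close> avoids the separate average that defines
    the constant cosine coefficient.\<close>
  have cos_eq: "cos_interp_coeff b f M j = 2 / real N * (- 1) ^ j * Re (?S j)" if "1 \<le> j" for j
    using that unfolding cos_interp_coeff_def Let_def N[symmetric] pow
    by (simp add: sum_distrib_left mult_ac)
  have sin_eq: "sin_interp_coeff b f M j = 2 / real N * (- 1) ^ j * Im (?S j)" for j
    unfolding sin_interp_coeff_def Let_def N[symmetric] pow
    by (simp add: sum_distrib_left mult_ac)
  \<comment> \<open>Stated for any \<open>r\<close> dominated by the Fourier sum, so that it applies
    to both its real and its imaginary part.\<close>
  have bound: "\<bar>2 / real N * (- 1) ^ j * r\<bar>
      \<le> ?B / (real N ^ (K + 1) * sin (pi * real j / real N) ^ (K + 1))"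
    if "1 \<le> j" "j < M" "\<bar>r\<bar> \<le> norm (?S j)" for j r
  proof -
    have "\<bar>r\<bar> \<le> real N * (b ^ (K + 1) * D / (real N ^ (K + 1) * sin (pi * real j / real N) ^ (K + 1)))"
      using that(3) norm_discrete_Fourier_sum_le[OF assms(1) per ex, of D j N] bd that(1,2) N
      by fastforce
    then have "2 / real N * \<bar>r\<bar> \<le> 2 / real N *
        (real N * (b ^ (K + 1) * D / (real N ^ (K + 1) * sin (pi * real j / real N) ^ (K + 1))))"
      by (rule mult_left_mono) simp
    also have "\<dots> = ?B / (real N ^ (K + 1) * sin (pi * real j / real N) ^ (K + 1))"
      using \<open>N > 0\<close> by (simp del: power_Suc)
    finally show ?thesis by (simp add: abs_mult)
  qed
  show "(even_function f \<longrightarrow>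
       (\<forall>j. 1 \<le> j \<and> j < M \<longrightarrow>
          \<bar>cos_interp_coeff b f M j\<bar> \<le> ?B / (real N ^ (K + 1) * sin (pi * real j / real N) ^ (K + 1)))) \<and>
    (odd_function f \<longrightarrow>
       (\<forall>j. 1 \<le> j \<and> j < M \<longrightarrow>
          \<bar>sin_interp_coeff b f M j\<bar> \<le> ?B / (real N ^ (K + 1) * sin (pi * real j / real N) ^ (K + 1))))"
    using bound[OF _ _ abs_Re_le_cmod] bound[OF _ _ abs_Im_le_cmod] cos_eq sin_eq by simp
qed

end
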